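(* Let $\mathcal H$ be a real Hilbert space, let $f_1,f_2:\mathcal H\to(-\infty,+\infty]$ be proper lower semicontinuous convex functions, and let $\lambda_1,\lambda_2>0$ with $\lambda_1+\lambda_2=1$. Set $$S:=\{(x,y): x=\operatorname{Prox}_{f_1/\lambda_2}y,\ y=\operatorname{Prox}_{f_2/\lambda_1}x\},\quad E:=\operatorname{Fix}(\operatorname{Prox}_{f_1/\lambda_2}\operatorname{Prox}_{f_2/\lambda_1}),\quad F:=\operatorname{Fix}(\operatorname{Prox}_{f_2/\lambda_1}\operatorname{Prox}_{f_1/\lambda_2}),$$ and, for $x,y,z\in\mathcal H$, $$g(x,y):=\frac{f_1(x)}{\lambda_2}+\frac{f_2(y)}{\lambda_1}+\frac{\|x-y\|^2}{2},\quad g_1(x):=\frac{f_1(x)}{\lambda_2}+e_1(f_2/\lambda_1)(x),$$ $$g_2(y):=e_1(f_1/\lambda_2)(y)+\frac{f_2(y)}{\lambda_1},\quad g_3(z):=\lambda_1e_1f_1(z)+\lambda_2e_1f_2(z),$$ $$p(z):=\inf_{z=\lambda_1x+\lambda_2y}\Big(\lambda_1f_1(x)+\lambda_2f_2(y)+\frac{\lambda_1\lambda_2}{2}\|x-y\|^2\Big).$$ Then: (i) $S=\operatorname{argmin}g\subseteq E\times F$. (ii) $E=\operatorname{argmin}g_1$. (iii) $F=\operatorname{argmin}g_2$. (iv) $\operatorname{argmin}p=\operatorname{argmin}g_3=\big[\lambda_1\,{}^1(\partial f_1)+\lambda_2\,{}^1(\partial f_2)\big]^{-1}(0)$. (v)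 $\operatorname{argmin}p=\{\lambda_1x+\lambda_2y:(x,y)\in S\}=\operatorname{Fix}(\operatorname{Prox}_p)=\operatorname{Fix}(\lambda_1\operatorname{Prox}_{f_1}+\lambda_2\operatorname{Prox}_{f_2})$. (vi) The sets $S$, $E$, $F$, $\operatorname{Fix}(\lambda_1\operatorname{Prox}_{f_1}+\lambda_2\operatorname{Prox}_{f_2})$ are closed and convex.
   Context: For proper lower semicontinuous convex $f$ on $\mathcal H$: $\partial f$ is the convex subdifferential; $\operatorname{Prox}_f:=J_{\partial f}=(\operatorname{Id}+\partial f)^{-1}$ is the proximal mapping (single-valued, full domain); $e_\gamma f(x):=\inf_y\big(f(y)+\frac1{2\gamma}\|x-y\|^2\big)$ is the Moreau envelope. The function $p$ (the proximal average of $f_1,f_2$ with weights $\lambda_1,\lambda_2$ and parameter $1$) is proper, lower semicontinuous and convex. For a maximal monotone $B$, ${}^1\!B:=\operatorname{Id}-J_B$ with $J_B=(B+\operatorname{Id})^{-1}$, so ${}^1(\partial f)=\operatorname{Id}-\operatorname{Prox}_f$. $\operatorname{Fix}T=\{x:Tx=x\}$; $\operatorname{argmin}$ is the (possibly empty) set of minimizers. *)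

theory Defs
  imports "HOL-Analysis.Analysis"
begin

definition proper :: "('a \<Rightarrow> ereal) \<Rightarrow> bool" where
  "proper f \<longleftrightarrow> (\<forall>x. f x \<noteq> -\<infinity>) \<and> (\<exists>x. f x \<noteq> \<infinity>)"

definition lsc :: "('a::topological_space \<Rightarrow> ereal) \<Rightarrow> bool" where
  "lsc f \<longleftrightarrow> (\<forall>x. f x \<le> Liminf (at x) f)"

text \<open>The library's \<open>convex_on\<close> covers real-valued functions only. Restricting to the open
  interval keeps products \<open>0 * \<infinity>\<close> out of the inequality.\<close>

definition ereal_convex :: "('a::real_vector \<Rightarrow> ereal) \<Rightarrow> bool" where
  "ereal_convex f \<longleftrightarrow>
     (\<forall>x y. \<forall>t\<in>{0<..<1}.
        f ((1 - t) *\<^sub>R x + t *\<^sub>R y) \<le> ereal (1 - t) * f x + ereal t * f y)"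

definition subdiff :: "('a::real_inner \<Rightarrow> ereal) \<Rightarrow> 'a \<Rightarrow> 'a set" where
  "subdiff f x = {u. \<forall>y. f x + ereal (u \<bullet> (y - x)) \<le> f y}"

text \<open>Set-valued operators are functions into sets. The set inside \<open>the_elem\<close> is the value
  of \<open>(Id + B)\<inverse>\<close> at \<open>x\<close>; it is a singleton for every \<open>x\<close> when \<open>B\<close> is maximal monotone,
  in particular when \<open>B\<close> is the subdifferential of a proper lower semicontinuous convex
  function on a Hilbert space. In other cases \<open>resolvent B x\<close> may be unspecified.\<close>

definition resolvent :: "('a::real_vector \<Rightarrow> 'a set) \<Rightarrow> 'a \<Rightarrow> 'a" where
  "resolvent B x = the_elem {y. \<exists>u\<in>B y. x = y + u}"

definition prox :: "('a::real_inner \<Rightarrow> ereal) \<Rightarrow> 'a \<Rightarrow> 'a" where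
  "prox f = resolvent (subdiff f)"

text \<open>\<open>yosida1 B\<close> is the Yosida regularization of \<open>B\<close> with parameter 1.\<close>

definition yosida1 :: "('a::real_vector \<Rightarrow> 'a set) \<Rightarrow> 'a \<Rightarrow> 'a" where
  "yosida1 B x = x - resolvent B x"

definition moreau_env :: "real \<Rightarrow> ('a::real_normed_vector \<Rightarrow> ereal) \<Rightarrow> 'a \<Rightarrow> ereal" where
  "moreau_env \<gamma> f x = (INF y. f y + ereal (1 / (2 * \<gamma>) * (norm (x - y))\<^sup>2))"

definition prox_avg ::
  "('a::real_normed_vector \<Rightarrow> ereal) \<Rightarrow> ('a \<Rightarrow> ereal) \<Rightarrow> real \<Rightarrow> real \<Rightarrow> 'a \<Rightarrow> ereal" where
  "prox_avg f1 f2 l1 l2 z =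
     (INF (x, y)\<in>{(x, y). z = l1 *\<^sub>R x + l2 *\<^sub>R y}.
        ereal l1 * f1 x + ereal l2 * f2 y + ereal (l1 * l2 / 2 * (norm (x - y))\<^sup>2))"

definition Fix :: "('a \<Rightarrow> 'a) \<Rightarrow> 'a set" where
  "Fix T = {x. T x = x}"

definition argmin :: "('a \<Rightarrow> ereal) \<Rightarrow> 'a set" where
  "argmin h = {x. is_arg_min h (\<lambda>_. True) x}"

end

theory Submission
  imports Defs
begin

text \<open>
  Everything rests on one translation: for a proper lower semicontinuous convex \<open>f\<close>, the
  three conditions \<open>y = prox f x\<close>, \<open>x - y \<in> subdiff f y\<close>, and ``\<open>y\<close> minimizes
  \<open>f + \<parallel>x - \<cdot>\<parallel>\<^sup>2 / 2\<close>'' are equivalent (\<open>prox_iff_subgradient\<close>, \<open>prox_iff_minimizer\<close>).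
  The existence of a minimizer (\<open>prox_minimizer_exists\<close>) is where completeness of the space and
  lower semicontinuity enter. Monotonicity of the subdifferential makes \<open>prox f\<close> single-valued
  and nonexpansive.

  Coupled and partial minimization. If \<open>(x, y)\<close> minimizes \<open>g\<close>, then \<open>x\<close> and \<open>y\<close>
  minimize \<open>g\<close> in their own variable, so each is a proximal point of the other; conversely the
  two subgradients \<open>y - x\<close> and \<open>x - y\<close> add up to a global lower bound for \<open>g\<close>
  (\<open>argmin_coupled\<close>). Minimizing out \<open>y\<close> turns \<open>g\<close> into \<open>g1\<close>, and minimizing out
  \<open>x\<close> turns it into \<open>g2\<close>; the optimal inner variable is a proximal point, which produces the
  two compositions (\<open>argmin_partial_envelope\<close>).

  The function \<open>g3\<close> is differentiable and convex with gradient
  \<open>l1 (z - prox f1 z) + l2 (z - prox f2 z)\<close>, so its minimizers are the zeros of that gradient,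
  that is, the fixed points of \<open>T = l1 prox f1 + l2 prox f2\<close>.

  The proximal average \<open>p\<close> satisfies \<open>prox p = T\<close>: with \<open>x = prox f1 z\<close> and
  \<open>y = prox f2 z\<close>, an explicit identity shows that \<open>z - T z\<close> is a subgradient of \<open>p\<close>
  at \<open>T z\<close> (\<open>prox_avg_subgradient\<close>), and by monotonicity one such subgradient determines the
  proximal point. Finally, if \<open>z = l1 x + l2 y\<close>, then
  \<open>z - x = l2 (y - x)\<close> and \<open>z - y = l1 (x - y)\<close>, so the subgradient conditions
  for \<open>x = prox f1 z\<close>, \<open>y = prox f2 z\<close> are, up to the scaling of \<open>f1\<close> and \<open>f2\<close>, the
  conditions defining \<open>S\<close>.

  All four sets in the last claim are fixed-point sets of nonexpansive mappings of a Hilbert space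
  (for \<open>S\<close>, of a mapping of the product space that takes a proximal step in each component
  from the other one), and such sets are closed and convex.
\<close>

section \<open>Subgradients\<close>

lemma argmin_iff: "x \<in> argmin h \<longleftrightarrow> (\<forall>y. h x \<le> h y)"
  by (auto simp: argmin_def is_arg_min_def not_less)

lemma subdiff_finite:
  assumes "proper f" "u \<in> subdiff f x"
  obtains r where "f x = ereal r"
proof -
  obtain a where "f a \<noteq> \<infinity>" using assms(1) by (auto simp: proper_def)
  moreover have "f x + ereal (u \<bullet> (a - x)) \<le> f a" using assms(2) by (auto simp: subdiff_def)
  moreover have "f x \<noteq> -\<infinity>" using assms(1) by (auto simp: proper_def)
  ultimately show ?thesis using that by (cases "f x") auto
qed

lemma subdiff_monotone:
  assumes "proper f" "u \<in> subdiff f x" "v \<in> subdiff f y"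
  shows "0 \<le> (u - v) \<bullet> (x - y)"
proof -
  obtain r s where rs: "f x = ereal r" "f y = ereal s"
    using subdiff_finite assms by metis
  have "f x + ereal (u \<bullet> (y - x)) \<le> f y" "f y + ereal (v \<bullet> (x - y)) \<le> f x"
    using assms by (auto simp: subdiff_def)
  then show ?thesis by (simp add: rs inner_simps)
qed

lemma argmin_iff_zero_subgradient: "x \<in> argmin h \<longleftrightarrow> 0 \<in> subdiff h x"
  by (simp add: argmin_iff subdiff_def)

text \<open>Monotonicity of \<open>subdiff f\<close> leaves at most one candidate for the proximal point, so one
  explicit subgradient identifies it. The proximal average is treated in this way.\<close>

lemma prox_eqI:
  fixes f :: "'a::real_inner \<Rightarrow> ereal"
  assumes "proper f" "x - y \<in> subdiff f y"
  shows "prox f x = y"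
proof -
  have "y' = y" if "x - y' \<in> subdiff f y'" for y'
  proof -
    have "0 \<le> ((x - y') - (x - y)) \<bullet> (y' - y)"
      using subdiff_monotone[OF assms(1) that assms(2)] .
    then have "(y' - y) \<bullet> (y' - y) \<le> 0" by (simp add: inner_simps inner_commute)
    then have "(y' - y) \<bullet> (y' - y) = 0" using inner_ge_zero[of "y' - y"] by linarith
    then show ?thesis unfolding inner_eq_zero_iff by simp
  qed
  then have "{y. x - y \<in> subdiff f y} = {y}"
    using assms(2) by blast
  moreover have "(\<exists>u\<in>subdiff f y. x = y + u) \<longleftrightarrow> x - y \<in> subdiff f y" for y
    by (metis add.commute add_diff_cancel_left' diff_add_cancel)
  ultimately show ?thesis by (simp add: prox_def resolvent_def)
qed

section \<open>Existence of the proximal point\<close>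

text \<open>\<open>lsc\<close> uses the punctured filter \<open>at x\<close>; a minimizing sequence may hit its limit, so full
  neighbourhoods are the useful form.\<close>

lemma lsc_eventually:
  assumes "lsc f" "c < f x"
  shows "\<forall>\<^sub>F y in nhds x. c < f y"
proof -
  have "c < Liminf (at x) f" using assms by (auto simp: lsc_def intro: less_le_trans)
  then have "\<forall>\<^sub>F y in at x. c < f y" by (rule less_LiminfD)
  then show ?thesis
    using assms(2) by (auto simp: eventually_at_filter elim: eventually_mono)
qed

lemma lsc_eventuallyI:
  assumes "\<And>x c. c < f x \<Longrightarrow> \<forall>\<^sub>F y in nhds x. c < f y"
  shows "lsc f"
  unfolding lsc_def le_Liminf_iff eventually_at_filter
proof (intro allI impI)
  fix x c assume "c < f x"
  then have "\<forall>\<^sub>F y in nhds x. c < f y" by (rule assms)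
  then show "\<forall>\<^sub>F y in nhds x. y \<noteq> x \<longrightarrow> y \<in> UNIV \<longrightarrow> c < f y"
    by (rule eventually_mono) simp
qed

lemma ereal_convexD:
  assumes "ereal_convex f" "0 < t" "t < 1"
  shows "f ((1 - t) *\<^sub>R x + t *\<^sub>R y) \<le> ereal (1 - t) * f x + ereal t * f y"
  by (rule assms(1)[unfolded ereal_convex_def, rule_format]) (use assms(2,3) in simp)

text \<open>A convex function that is bounded below near \<open>x0\<close> can decrease at most linearly: a steep
  descent far away would, by convexity along the segment, already be visible near \<open>x0\<close>. This
  is what makes \<open>f\<close> plus a quadratic bounded below, without a separation theorem.\<close>

lemma convex_lsc_lower_bound:
  fixes f :: "'a::real_inner \<Rightarrow> ereal"
  assumes "lsc f" "ereal_convex f" and x0: "f x0 = ereal r"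
  obtains C K where "0 \<le> K" "\<And>y. ereal (C - K * norm (y - x0)) \<le> f y"
proof -
  have "\<forall>\<^sub>F y in nhds x0. ereal (r - 1) < f y"
    by (rule lsc_eventually[OF assms(1)]) (simp add: x0)
  then obtain d where d: "d > 0" "\<And>y. dist y x0 < d \<Longrightarrow> ereal (r - 1) < f y"
    by (auto simp: eventually_nhds_metric)
  show ?thesis
  proof (rule that[of "2 / d" "r - 1"])
    fix y
    show "ereal (r - 1 - 2 / d * norm (y - x0)) \<le> f y"
    proof (cases "norm (y - x0) < d")
      case True
      then have "ereal (r - 1) < f y" using d by (simp add: dist_norm)
      moreover have "0 \<le> 2 / d * norm (y - x0)" using d(1) by simp
      ultimately show ?thesis
        by (cases "f y") auto
    next
      case False
      \<comment> \<open>The point of the segment at distance \<open>d / 2\<close> from \<open>x0\<close>, hence inside the ball.\<close>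
      define t where "t = d / (2 * norm (y - x0))"
      have n: "norm (y - x0) > 0" using False d(1) by linarith
      have t: "0 < t" "t < 1" using False d(1) n unfolding t_def by (simp_all add: field_simps)
      have "norm (t *\<^sub>R (y - x0)) = d / 2" using n d(1) by (simp add: t_def)
      moreover have "((1 - t) *\<^sub>R x0 + t *\<^sub>R y) - x0 = t *\<^sub>R (y - x0)"
        by (simp add: algebra_simps)
      ultimately have "dist ((1 - t) *\<^sub>R x0 + t *\<^sub>R y) x0 < d"
        using d(1) unfolding dist_norm by simp
      then have "ereal (r - 1) < f ((1 - t) *\<^sub>R x0 + t *\<^sub>R y)" by (rule d)
      also have "\<dots> \<le> ereal (1 - t) * f x0 + ereal t * f y"
        by (rule ereal_convexD[OF assms(2) t])
      finally have *: "ereal (r - 1) < ereal ((1 - t) * r) + ereal t * f y" by (simp add: x0)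
      show ?thesis
      proof (cases "f y")
        case (real s)
        with * have "t * (r - s) < 1" by (simp add: algebra_simps)
        then have "r - s < 1 / t" using t by (simp add: field_simps)
        also have "1 / t = 2 / d * norm (y - x0)" by (simp add: t_def)
        finally show ?thesis using real by simp
      next
        case MInf
        with * t show ?thesis by simp
      qed simp
    qed
  qed (use d(1) in simp)
qed

text \<open>The quadratic term dominates the linear lower bound for \<open>f\<close>, so the infimum is finite. It also makes
  the objective strongly convex, so a minimizing sequence is Cauchy, and lower semicontinuity
  passes the bound to its limit.\<close>

lemma prox_minimizer_exists:
  fixes f :: "'a::{real_inner, complete_space} \<Rightarrow> ereal"
  assumes "proper f" "lsc f" "ereal_convex f"
  obtains y where "\<And>a. f y + ereal ((norm (x - y))\<^sup>2 / 2) \<le> f a + ereal ((norm (x - a))\<^sup>2 / 2)"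
proof -
  define D where "D = {a. f a \<noteq> \<infinity>}"
  define h where "h = (\<lambda>a. real_of_ereal (f a))"
  have fh: "f a = ereal (h a)" if "a \<in> D" for a
    using that assms(1) by (cases "f a") (auto simp: D_def h_def proper_def)
  have fD: "a \<in> D" if "f a \<le> ereal c" for a c
    using that by (auto simp: D_def)
  obtain x0 where x0: "x0 \<in> D" using assms(1) by (auto simp: proper_def D_def)
  define \<phi> where "\<phi> = (\<lambda>a. h a + (norm (x - a))\<^sup>2 / 2)"
  obtain C K where K: "0 \<le> K" and lb: "\<And>y. ereal (C - K * norm (y - x0)) \<le> f y"
    using convex_lsc_lower_bound[OF assms(2,3) fh[OF x0]] by metis
  \<comment> \<open>The constant comes from completing the square \<open>(norm (x - a) - K)\<^sup>2\<close>.\<close>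
  have low: "C - K * norm (x - x0) - K\<^sup>2 / 2 \<le> \<phi> a" if "a \<in> D" for a
  proof -
    have "C - K * norm (a - x0) \<le> h a" using lb[of a] fh[OF that] by simp
    moreover have "norm (a - x0) \<le> norm (x - a) + norm (x - x0)"
      using norm_triangle_ineq4[of "x - x0" "x - a"] by (simp add: algebra_simps)
    then have "K * norm (a - x0) \<le> K * norm (x - a) + K * norm (x - x0)"
      using K by (metis mult_left_mono distrib_left)
    moreover have "0 \<le> (norm (x - a) - K)\<^sup>2" by simp
    then have "K * norm (x - a) \<le> (norm (x - a))\<^sup>2 / 2 + K\<^sup>2 / 2"
      by (simp add: power2_eq_square algebra_simps)
    ultimately show ?thesis unfolding \<phi>_def by linarith
  qed
  then have bdd: "bdd_below (\<phi> ` D)" by (auto intro!: bdd_belowI2)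
  define m where "m = (INF a\<in>D. \<phi> a)"
  have m_le: "m \<le> \<phi> a" if "a \<in> D" for a
    unfolding m_def using bdd that by (rule cINF_lower)
  have "\<exists>a\<in>D. \<phi> a < m + 1 / real (Suc n)" for n
  proof -
    have "(INF a\<in>D. \<phi> a) < m + 1 / real (Suc n)" by (simp add: m_def)
    then show ?thesis using cINF_less_iff[of D \<phi>] x0 bdd by auto
  qed
  then obtain s where s: "\<And>n. s n \<in> D" "\<And>n. \<phi> (s n) < m + 1 / real (Suc n)" by metis
  \<comment> \<open>The parallelogram identity at the midpoint: two almost minimal points are close.\<close>
  have mid: "(norm (a - b))\<^sup>2 \<le> 4 * (\<phi> a - m) + 4 * (\<phi> b - m)" if "a \<in> D" "b \<in> D" for a b
  proof -
    let ?c = "(1 - 1/2) *\<^sub>R a + (1/2) *\<^sub>R b"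
    have "f ?c \<le> ereal (1 - 1/2) * f a + ereal (1/2) * f b"
      by (rule ereal_convexD[OF assms(3)]) simp_all
    then have *: "f ?c \<le> ereal (h a / 2 + h b / 2)" using that by (simp add: fh)
    then have "?c \<in> D" by (rule fD)
    then have "h ?c \<le> h a / 2 + h b / 2" "m \<le> \<phi> ?c" using * m_le by (auto simp: fh)
    moreover have "(norm (x - ?c))\<^sup>2 = (norm (x - a))\<^sup>2 / 2 + (norm (x - b))\<^sup>2 / 2 - (norm (a - b))\<^sup>2 / 4"
      by (simp add: power2_norm_eq_inner inner_simps inner_commute field_simps)
    ultimately show ?thesis unfolding \<phi>_def by argo
  qed
  have "Cauchy s"
  proof (rule metric_CauchyI)
    fix e :: real assume e: "e > 0"
    obtain N where N: "8 / e\<^sup>2 < real N" using reals_Archimedean2 by blast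
    have N0: "real N > 0" using N e by (smt (verit) zero_le_divide_iff zero_le_power2)
    have "dist (s i) (s j) < e" if "i \<ge> N" "j \<ge> N" for i j
    proof -
      have "1 / real (Suc i) \<le> 1 / real N" "1 / real (Suc j) \<le> 1 / real N"
        using that N0 by (auto intro!: divide_left_mono)
      then have "(norm (s i - s j))\<^sup>2 < 8 / real N"
        using mid[OF s(1)[of i] s(1)[of j]] s(2)[of i] s(2)[of j] by simp
      also have "\<dots> < e\<^sup>2" using N N0 e by (simp add: field_simps)
      finally show ?thesis using e by (simp add: dist_norm power_less_imp_less_base)
    qed
    then show "\<exists>M. \<forall>i\<ge>M. \<forall>j\<ge>M. dist (s i) (s j) < e" by blast
  qed
  then obtain y where y: "s \<longlonglongrightarrow> y" using Cauchy_convergent convergent_def by blast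
  let ?L = "m - (norm (x - y))\<^sup>2 / 2"
  have inv: "(\<lambda>n. 1 / real (Suc n)) \<longlonglongrightarrow> 0"
    by (rule LIMSEQ_Suc[OF lim_1_over_n])
  have "(\<lambda>n. m + 1 / real (Suc n) - (norm (x - s n))\<^sup>2 / 2) \<longlonglongrightarrow> m + 0 - (norm (x - y))\<^sup>2 / 2"
    by (intro inv y tendsto_add tendsto_diff tendsto_divide[OF _ tendsto_const] tendsto_power
        tendsto_norm tendsto_const) simp_all
  then have L: "(\<lambda>n. m + 1 / real (Suc n) - (norm (x - s n))\<^sup>2 / 2) \<longlonglongrightarrow> ?L" by simp
  have fy: "f y \<le> ereal ?L"
  proof (rule dense_le)
    fix c assume "c < f y"
    then have ev: "\<forall>\<^sub>F n in sequentially. c < f (s n)"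
      by (intro eventually_compose_filterlim[OF lsc_eventually[OF assms(2)] y])
    then have "\<forall>\<^sub>F n in sequentially. c \<le> ereal (m + 1 / real (Suc n) - (norm (x - s n))\<^sup>2 / 2)"
    proof (rule eventually_mono)
      fix n assume "c < f (s n)"
      also have "f (s n) = ereal (\<phi> (s n) - (norm (x - s n))\<^sup>2 / 2)"
        using s(1)[of n] by (simp add: fh \<phi>_def)
      also have "\<dots> \<le> ereal (m + 1 / real (Suc n) - (norm (x - s n))\<^sup>2 / 2)"
        using s(2)[of n] by simp
      finally show "c \<le> ereal (m + 1 / real (Suc n) - (norm (x - s n))\<^sup>2 / 2)" by simp
    qed
    then show "c \<le> ereal ?L"
      by (intro tendsto_lowerbound[OF tendsto_ereal[OF L]]) auto
  qed
  then have yD: "y \<in> D" by (rule fD)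
  then have "\<phi> y \<le> m" using fy by (simp add: fh \<phi>_def)
  then have "\<phi> y \<le> \<phi> a" if "a \<in> D" for a using m_le[OF that] by simp
  then have "f y + ereal ((norm (x - y))\<^sup>2 / 2) \<le> f a + ereal ((norm (x - a))\<^sup>2 / 2)" for a
    by (cases "a \<in> D") (auto simp: fh yD \<phi>_def, auto simp: D_def)
  then show ?thesis by (rule that)
qed

section \<open>Characterisations of the proximal mapping\<close>

lemma subgradient_imp_prox_minimizer:
  fixes f :: "'a::real_inner \<Rightarrow> ereal"
  assumes "proper f" and "x - y \<in> subdiff f y"
  shows "f y + ereal ((norm (x - y))\<^sup>2 / 2) \<le> f a + ereal ((norm (x - a))\<^sup>2 / 2)"
proof -
  obtain r where r: "f y = ereal r" using subdiff_finite[OF assms] .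
  have *: "f y + ereal ((x - y) \<bullet> (a - y)) \<le> f a" using assms(2) by (simp add: subdiff_def)
  have "(norm (x - a))\<^sup>2 = (norm (x - y))\<^sup>2 - 2 * ((x - y) \<bullet> (a - y)) + (norm (a - y))\<^sup>2"
    by (simp add: power2_norm_eq_inner inner_simps inner_commute)
  moreover have "0 \<le> (norm (a - y))\<^sup>2" by simp
  ultimately have "(norm (x - y))\<^sup>2 / 2 \<le> (x - y) \<bullet> (a - y) + (norm (x - a))\<^sup>2 / 2" by argo
  with * show ?thesis by (cases "f a") (auto simp: r)
qed

text \<open>Compare the minimum at \<open>y\<close> with the value at \<open>(1 - t) y + t a\<close>, divide by \<open>t\<close> and let
  \<open>t\<close> tend to \<open>0\<close>: the quadratic error disappears and the subgradient inequality remains.\<close>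

lemma prox_minimizer_imp_subgradient:
  fixes f :: "'a::real_inner \<Rightarrow> ereal"
  assumes "proper f" "ereal_convex f"
    and min: "\<And>a. f y + ereal ((norm (x - y))\<^sup>2 / 2) \<le> f a + ereal ((norm (x - a))\<^sup>2 / 2)"
  shows "x - y \<in> subdiff f y"
proof -
  obtain b where b: "f b \<noteq> \<infinity>" using assms(1) by (auto simp: proper_def)
  have nm: "f a \<noteq> -\<infinity>" for a using assms(1) by (auto simp: proper_def)
  obtain r where r: "f y = ereal r" using min[of b] b nm[of y] by (cases "f y") auto
  have "f y + ereal ((x - y) \<bullet> (a - y)) \<le> f a" for a
  proof (cases "f a")
    case (real s)
    let ?k = "r + (x - y) \<bullet> (a - y)"
    have bound: "?k \<le> s + t * ((norm (a - y))\<^sup>2 / 2)" if t: "0 < t" "t < 1" for t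
    proof -
      let ?c = "(1 - t) *\<^sub>R y + t *\<^sub>R a"
      have "f ?c \<le> ereal (1 - t) * f y + ereal t * f a"
        by (rule ereal_convexD[OF assms(2) t])
      then have fc: "f ?c \<le> ereal ((1 - t) * r + t * s)" by (simp add: r real)
      have "f y + ereal ((norm (x - y))\<^sup>2 / 2) \<le> ereal ((1 - t) * r + t * s) + ereal ((norm (x - ?c))\<^sup>2 / 2)"
        using min[of ?c] fc by (meson add_right_mono order_trans)
      then have "r + (norm (x - y))\<^sup>2 / 2 \<le> (1 - t) * r + t * s + (norm (x - ?c))\<^sup>2 / 2"
        by (simp add: r)
      moreover have "x - ?c = (x - y) - t *\<^sub>R (a - y)" by (simp add: algebra_simps)
      then have "(norm (x - ?c))\<^sup>2 = (norm (x - y))\<^sup>2 - 2 * t * ((x - y) \<bullet> (a - y)) + t\<^sup>2 * (norm (a - y))\<^sup>2"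
        unfolding power2_norm_eq_inner
        by (simp add: inner_diff_left inner_diff_right inner_commute power2_eq_square algebra_simps)
      ultimately have "t * ?k \<le> t * (s + t * ((norm (a - y))\<^sup>2 / 2))"
        by (simp add: algebra_simps power2_eq_square)
      then show ?thesis using t by simp
    qed
    have "((\<lambda>t. s + t * ((norm (a - y))\<^sup>2 / 2)) \<longlongrightarrow> s + 0 * ((norm (a - y))\<^sup>2 / 2)) (at_right 0)"
      by (intro tendsto_intros)
    moreover have "\<forall>\<^sub>F t in at_right (0::real). t < 1 \<and> 0 < t"
      by (intro eventually_conj eventually_at_right_less)
      (auto simp: eventually_at_right_field intro: exI[of _ 1])
    then have "\<forall>\<^sub>F t in at_right 0. ?k \<le> s + t * ((norm (a - y))\<^sup>2 / 2)"
      by (rule eventually_mono) (use bound in blast)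
    ultimately have "?k \<le> s + 0 * ((norm (a - y))\<^sup>2 / 2)"
      by (rule tendsto_lowerbound) simp
    then show ?thesis by (simp add: r real)
  qed (use nm in auto)
  then show ?thesis by (simp add: subdiff_def)
qed

lemma prox_iff_subgradient:
  fixes f :: "'a::{real_inner, complete_space} \<Rightarrow> ereal"
  assumes "proper f" "lsc f" "ereal_convex f"
  shows "y = prox f x \<longleftrightarrow> x - y \<in> subdiff f y"
proof -
  obtain q where "\<And>a. f q + ereal ((norm (x - q))\<^sup>2 / 2) \<le> f a + ereal ((norm (x - a))\<^sup>2 / 2)"
    using prox_minimizer_exists[OF assms] by metis
  then have q: "x - q \<in> subdiff f q"
    by (rule prox_minimizer_imp_subgradient[OF assms(1,3)])
  then have "prox f x = q" by (rule prox_eqI[OF assms(1)])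
  show ?thesis
  proof
    show "x - y \<in> subdiff f y" if "y = prox f x"
      using q unfolding that \<open>prox f x = q\<close> .
    show "y = prox f x" if "x - y \<in> subdiff f y"
      using prox_eqI[OF assms(1) that] by (rule sym)
  qed
qed

lemma prox_subgradient:
  fixes f :: "'a::{real_inner, complete_space} \<Rightarrow> ereal"
  assumes "proper f" "lsc f" "ereal_convex f"
  shows "x - prox f x \<in> subdiff f (prox f x)"
  using prox_iff_subgradient[OF assms, THEN iffD1, OF refl] .

lemma prox_iff_minimizer:
  fixes f :: "'a::{real_inner, complete_space} \<Rightarrow> ereal"
  assumes "proper f" "lsc f" "ereal_convex f"
  shows "y = prox f x \<longleftrightarrow>
    (\<forall>a. f y + ereal ((norm (x - y))\<^sup>2 / 2) \<le> f a + ereal ((norm (x - a))\<^sup>2 / 2))" (is "_ \<longleftrightarrow> ?min")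
proof
  assume "y = prox f x"
  then have "x - y \<in> subdiff f y" by (rule prox_iff_subgradient[OF assms, THEN iffD1])
  from subgradient_imp_prox_minimizer[OF assms(1) this] show ?min ..
next
  assume min: ?min
  have "x - y \<in> subdiff f y"
    by (rule prox_minimizer_imp_subgradient[OF assms(1,3) min[rule_format]])
  then show "y = prox f x" by (rule prox_iff_subgradient[OF assms, THEN iffD2])
qed

section \<open>Nonexpansive mappings\<close>

lemma prox_minimizes:
  fixes f :: "'a::{real_inner, complete_space} \<Rightarrow> ereal"
  assumes "proper f" "lsc f" "ereal_convex f"
  shows "f (prox f x) + ereal ((norm (x - prox f x))\<^sup>2 / 2) \<le> f a + ereal ((norm (x - a))\<^sup>2 / 2)"
  by (rule subgradient_imp_prox_minimizer[OF assms(1) prox_subgradient[OF assms]])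

lemma prox_nonexpansive:
  fixes f :: "'a::{real_inner, complete_space} \<Rightarrow> ereal"
  assumes "proper f" "lsc f" "ereal_convex f"
  shows "norm (prox f x - prox f y) \<le> norm (x - y)"
proof -
  let ?d = "prox f x - prox f y"
  have "0 \<le> ((x - prox f x) - (y - prox f y)) \<bullet> ?d"
    by (rule subdiff_monotone[OF assms(1)]; rule prox_subgradient[OF assms])
  then have "?d \<bullet> ?d \<le> (x - y) \<bullet> ?d" by (simp add: inner_simps inner_commute)
  also have "\<dots> \<le> norm (x - y) * norm ?d" by (rule norm_cauchy_schwarz)
  finally have "norm ?d * norm ?d \<le> norm (x - y) * norm ?d"
    by (simp add: power2_norm_eq_inner[symmetric] power2_eq_square)
  then show ?thesis by (cases "norm ?d = 0") (auto simp: mult_le_cancel_right)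
qed

lemma Fix_nonexpansive_closed:
  fixes T :: "'a::real_normed_vector \<Rightarrow> 'a"
  assumes "\<And>x y. norm (T x - T y) \<le> norm (x - y)"
  shows "closed (Fix T)"
proof -
  have "1-lipschitz_on UNIV T"
    by (rule lipschitz_onI) (use assms in \<open>auto simp: dist_norm\<close>)
  then have "continuous_on UNIV T" by (rule lipschitz_on_continuous_on)
  then show ?thesis unfolding Fix_def by (intro closed_Collect_eq) auto
qed

text \<open>If \<open>x\<close> and \<open>y\<close> are fixed and \<open>z\<close> lies on the segment between them, then \<open>T z\<close> is at
  least as close to \<open>x\<close> and to \<open>y\<close> as \<open>z\<close> is. In an inner product space \<open>z\<close> is the only
  such point, by the identity for the squared norm of a convex combination.\<close>

lemma Fix_nonexpansive_convex:
  fixes T :: "'a::real_inner \<Rightarrow> 'a"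
  assumes T: "\<And>x y. norm (T x - T y) \<le> norm (x - y)"
  shows "convex (Fix T)"
  unfolding convex_alt
proof (intro ballI allI impI)
  fix x y and t :: real
  assume x: "x \<in> Fix T" and y: "y \<in> Fix T" and "0 \<le> t \<and> t \<le> 1"
  then have t: "0 \<le> t" "t \<le> 1" by auto
  let ?z = "(1 - t) *\<^sub>R x + t *\<^sub>R y"
  let ?w = "T ?z"
  have "norm (?w - x) \<le> norm (?z - x)" using T[of ?z x] x by (simp add: Fix_def)
  also have "?z - x = t *\<^sub>R (y - x)" by (simp add: algebra_simps)
  finally have 1: "(norm (?w - x))\<^sup>2 \<le> t\<^sup>2 * (norm (x - y))\<^sup>2"
    using t by (metis abs_of_nonneg norm_scaleR norm_minus_commute norm_ge_zero power_mono power_mult_distrib)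
  have "norm (?w - y) \<le> norm (?z - y)" using T[of ?z y] y by (simp add: Fix_def)
  also have "?z - y = (1 - t) *\<^sub>R (x - y)" by (simp add: algebra_simps)
  finally have "norm (?w - y) \<le> (1 - t) * norm (x - y)" using t by simp
  then have 2: "(norm (?w - y))\<^sup>2 \<le> (1 - t)\<^sup>2 * (norm (x - y))\<^sup>2"
    by (metis norm_ge_zero power_mono power_mult_distrib)
  have split: "?w - ?z = (1 - t) *\<^sub>R (?w - x) + t *\<^sub>R (?w - y)" "x - y = (?w - y) - (?w - x)"
    by (simp_all add: algebra_simps)
  have "(norm ((1 - t) *\<^sub>R u + t *\<^sub>R v))\<^sup>2 = (1 - t) * (norm u)\<^sup>2 + t * (norm v)\<^sup>2 - t * (1 - t) * (norm (v - u))\<^sup>2"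
    for u v :: 'a
    unfolding power2_norm_eq_inner
    by (simp add: inner_add_left inner_add_right inner_diff_left inner_diff_right inner_commute algebra_simps)
  then have "(norm (?w - ?z))\<^sup>2
      = (1 - t) * (norm (?w - x))\<^sup>2 + t * (norm (?w - y))\<^sup>2 - t * (1 - t) * (norm (x - y))\<^sup>2"
    using split by metis
  also have "\<dots> \<le> (1 - t) * (t\<^sup>2 * (norm (x - y))\<^sup>2) + t * ((1 - t)\<^sup>2 * (norm (x - y))\<^sup>2)
      - t * (1 - t) * (norm (x - y))\<^sup>2"
    using 1 2 t by (intro diff_right_mono add_mono mult_left_mono) auto
  also have "\<dots> = 0" by (simp add: power2_eq_square algebra_simps)
  finally have "?w = ?z" by simp
  then show "?z \<in> Fix T" by (simp add: Fix_def)
qed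

section \<open>Moreau envelopes\<close>

lemma moreau_env_eq:
  fixes f :: "'a::{real_inner, complete_space} \<Rightarrow> ereal"
  assumes "proper f" "lsc f" "ereal_convex f"
  shows "moreau_env 1 f x = f (prox f x) + ereal ((norm (x - prox f x))\<^sup>2 / 2)"
  unfolding moreau_env_def
  using prox_minimizes[OF assms, of x]
  by (intro antisym INF_greatest INF_lower2[of "prox f x"]) auto

text \<open>The envelope is finite, convex and differentiable with the 1-Lipschitz gradient \<open>z - prox f z\<close>.
  The lower and the upper first-order bound record exactly what minimization needs of this.\<close>

lemma moreau_env_expansion:
  fixes f :: "'a::{real_inner, complete_space} \<Rightarrow> ereal"
  assumes "proper f" "lsc f" "ereal_convex f"
  obtains e where "\<And>z. moreau_env 1 f z = ereal (e z)"
    "\<And>z w. e z + (z - prox f z) \<bullet> (w - z) \<le> e w"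
    "\<And>z w. e w \<le> e z + (z - prox f z) \<bullet> (w - z) + (norm (w - z))\<^sup>2 / 2"
proof -
  have "\<exists>r. f (prox f z) = ereal r" for z
    using subdiff_finite[OF assms(1) prox_subgradient[OF assms]] by blast
  then obtain r where r: "\<And>z. f (prox f z) = ereal (r z)" by metis
  define e where "e z = r z + (norm (z - prox f z))\<^sup>2 / 2" for z
  have env: "moreau_env 1 f z = ereal (e z)" for z
    by (simp add: moreau_env_eq[OF assms] r e_def)
  have lower: "e z + (z - prox f z) \<bullet> (w - z) \<le> e w" for z w
  proof -
    let ?v = "z - prox f z" and ?t = "w - prox f w"
    have "f (prox f z) + ereal (?v \<bullet> (prox f w - prox f z)) \<le> f (prox f w)"
      using prox_subgradient[OF assms, of z] by (simp add: subdiff_def)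
    then have "r z + ?v \<bullet> (prox f w - prox f z) \<le> r w" by (simp add: r)
    moreover have "prox f w - prox f z = ?v - ?t + (w - z)" by simp
    then have "?v \<bullet> (prox f w - prox f z) = ?v \<bullet> ?v - ?v \<bullet> ?t + ?v \<bullet> (w - z)"
      by (simp only: inner_add_right inner_diff_right)
    moreover have "0 \<le> (?v - ?t) \<bullet> (?v - ?t)" by simp
    then have "0 \<le> ?v \<bullet> ?v - 2 * (?v \<bullet> ?t) + ?t \<bullet> ?t"
      by (simp only: inner_diff_left inner_diff_right inner_commute) argo
    ultimately show ?thesis unfolding e_def power2_norm_eq_inner by argo
  qed
  have upper: "e w \<le> e z + (z - prox f z) \<bullet> (w - z) + (norm (w - z))\<^sup>2 / 2" for z w
  proof -
    have "moreau_env 1 f w \<le> f (prox f z) + ereal ((norm (w - prox f z))\<^sup>2 / 2)"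
      unfolding moreau_env_eq[OF assms] by (rule prox_minimizes[OF assms])
    then have "e w \<le> r z + (norm (w - prox f z))\<^sup>2 / 2" by (simp add: env r)
    moreover have "(norm (w - prox f z))\<^sup>2
        = (norm (z - prox f z))\<^sup>2 + 2 * ((z - prox f z) \<bullet> (w - z)) + (norm (w - z))\<^sup>2"
      unfolding power2_norm_eq_inner by (simp add: inner_diff_left inner_diff_right inner_commute)
    ultimately show ?thesis unfolding e_def by argo
  qed
  show ?thesis using that env lower upper by blast
qed

text \<open>The first-order bounds carry over to the convex combination, whose gradient at \<open>z\<close> is \<open>G\<close>, the
  vector on the right. The lower one makes a zero of \<open>G\<close> a minimizer; by the upper one, going
  from \<open>z\<close> to \<open>z - G\<close> decreases the value by at least \<open>\<parallel>G\<parallel>\<^sup>2 / 2\<close>.\<close>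

lemma argmin_moreau_env_combination:
  fixes f1 f2 :: "'a::{real_inner, complete_space} \<Rightarrow> ereal"
  assumes f1: "proper f1" "lsc f1" "ereal_convex f1"
    and f2: "proper f2" "lsc f2" "ereal_convex f2"
    and weights: "l1 > 0" "l2 > 0" "l1 + l2 = 1"
  shows "z \<in> argmin (\<lambda>z. ereal l1 * moreau_env 1 f1 z + ereal l2 * moreau_env 1 f2 z)
    \<longleftrightarrow> l1 *\<^sub>R (z - prox f1 z) + l2 *\<^sub>R (z - prox f2 z) = 0" (is "_ \<longleftrightarrow> ?G = 0")
proof -
  obtain e1 where e1: "\<And>z. moreau_env 1 f1 z = ereal (e1 z)"
    and lo1: "\<And>z w. e1 z + (z - prox f1 z) \<bullet> (w - z) \<le> e1 w"
    and up1: "\<And>z w. e1 w \<le> e1 z + (z - prox f1 z) \<bullet> (w - z) + (norm (w - z))\<^sup>2 / 2"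
    using moreau_env_expansion[OF f1] by metis
  obtain e2 where e2: "\<And>z. moreau_env 1 f2 z = ereal (e2 z)"
    and lo2: "\<And>z w. e2 z + (z - prox f2 z) \<bullet> (w - z) \<le> e2 w"
    and up2: "\<And>z w. e2 w \<le> e2 z + (z - prox f2 z) \<bullet> (w - z) + (norm (w - z))\<^sup>2 / 2"
    using moreau_env_expansion[OF f2] by metis
  define e where "e w = l1 * e1 w + l2 * e2 w" for w
  have am: "z \<in> argmin (\<lambda>z. ereal l1 * moreau_env 1 f1 z + ereal l2 * moreau_env 1 f2 z)
      \<longleftrightarrow> (\<forall>w. e z \<le> e w)"
    by (simp add: argmin_iff e1 e2 e_def)
  have G: "?G \<bullet> d = l1 * ((z - prox f1 z) \<bullet> d) + l2 * ((z - prox f2 z) \<bullet> d)" for d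
    by (simp only: inner_add_left inner_scaleR_left)
  have lower: "e z + ?G \<bullet> (w - z) \<le> e w" for w
    using add_mono[OF mult_left_mono[OF lo1[of z w], of l1] mult_left_mono[OF lo2[of z w], of l2]]
      weights(1,2) unfolding e_def G by (simp add: algebra_simps)
  have upper: "e w \<le> e z + ?G \<bullet> (w - z) + (norm (w - z))\<^sup>2 / 2" for w
  proof -
    have "(norm (w - z))\<^sup>2 / 2 = l1 * ((norm (w - z))\<^sup>2 / 2) + l2 * ((norm (w - z))\<^sup>2 / 2)"
      using weights(3) by (metis distrib_right mult_1)
    then show ?thesis
      using add_mono[OF mult_left_mono[OF up1[of w z], of l1] mult_left_mono[OF up2[of w z], of l2]]
        weights(1,2) unfolding e_def G distrib_left by linarith
  qed
  show ?thesis
  proof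
    assume "?G = 0"
    then show "z \<in> argmin (\<lambda>z. ereal l1 * moreau_env 1 f1 z + ereal l2 * moreau_env 1 f2 z)"
      unfolding am using lower by simp
  next
    assume "z \<in> argmin (\<lambda>z. ereal l1 * moreau_env 1 f1 z + ereal l2 * moreau_env 1 f2 z)"
    then have "e z \<le> e (z - ?G)" unfolding am by blast
    moreover have "z - u - z = - u" for u :: 'a by simp
    then have "e (z - ?G) \<le> e z - ?G \<bullet> ?G + (norm ?G)\<^sup>2 / 2"
      using upper[of "z - ?G"] by (simp only: norm_minus_cancel inner_minus_right diff_conv_add_uminus)
    ultimately have "(norm ?G)\<^sup>2 \<le> 0" unfolding power2_norm_eq_inner by argo
    then show "?G = 0" by simp
  qed
qed

section \<open>Alternating proximal steps\<close>

text \<open>A minimizer is minimal in each variable separately. For the converse, sum the subgradient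
  inequalities for \<open>y - x\<close> and \<open>x - y\<close>; with \<open>u = x - y\<close> and \<open>v = a - b\<close> what is left over is
  \<open>\<parallel>u - v\<parallel>\<^sup>2 / 2 \<ge> 0\<close>.\<close>

lemma argmin_coupled:
  fixes f h :: "'a::{real_inner, complete_space} \<Rightarrow> ereal"
  assumes f: "proper f" "lsc f" "ereal_convex f"
    and h: "proper h" "lsc h" "ereal_convex h"
  shows "(x, y) \<in> argmin (\<lambda>(x, y). f x + h y + ereal ((norm (x - y))\<^sup>2 / 2))
    \<longleftrightarrow> x = prox f y \<and> y = prox h x"
proof
  assume "(x, y) \<in> argmin (\<lambda>(x, y). f x + h y + ereal ((norm (x - y))\<^sup>2 / 2))"
  then have min: "f x + h y + ereal ((norm (x - y))\<^sup>2 / 2) \<le> f a + h b + ereal ((norm (a - b))\<^sup>2 / 2)" for a b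
    by (auto simp: argmin_iff)
  have nm: "f a \<noteq> -\<infinity>" "h a \<noteq> -\<infinity>" for a using f h by (auto simp: proper_def)
  obtain a0 b0 where "f a0 \<noteq> \<infinity>" "h b0 \<noteq> \<infinity>" using f h by (auto simp: proper_def)
  then have "f x \<noteq> \<infinity>" "h y \<noteq> \<infinity>" using min[of a0 b0] nm[of a0] nm[of b0] by auto
  then obtain r s where rs: "f x = ereal r" "h y = ereal s" using nm[of x] nm[of y]
    by (cases "f x"; cases "h y") auto
  have "f x + ereal ((norm (y - x))\<^sup>2 / 2) \<le> f a + ereal ((norm (y - a))\<^sup>2 / 2)" for a
    using min[of a y] nm[of a] by (cases "f a") (auto simp: rs norm_minus_commute)
  moreover have "h y + ereal ((norm (x - y))\<^sup>2 / 2) \<le> h b + ereal ((norm (x - b))\<^sup>2 / 2)" for b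
    using min[of x b] nm[of b] by (cases "h b") (auto simp: rs)
  ultimately show "x = prox f y \<and> y = prox h x"
    by (intro conjI prox_iff_minimizer[OF f, THEN iffD2] prox_iff_minimizer[OF h, THEN iffD2] allI)
next
  assume xy: "x = prox f y \<and> y = prox h x"
  have sub: "y - x \<in> subdiff f x" "x - y \<in> subdiff h y"
    by (rule prox_iff_subgradient[OF f, THEN iffD1, OF conjunct1[OF xy]],
        rule prox_iff_subgradient[OF h, THEN iffD1, OF conjunct2[OF xy]])
  obtain r where r: "f x = ereal r" using subdiff_finite[OF f(1) sub(1)] .
  obtain s where s: "h y = ereal s" using subdiff_finite[OF h(1) sub(2)] .
  have "f x + h y + ereal ((norm (x - y))\<^sup>2 / 2) \<le> f a + h b + ereal ((norm (a - b))\<^sup>2 / 2)" for a b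
  proof -
    have 1: "f x + ereal ((y - x) \<bullet> (a - x)) \<le> f a" using sub by (simp add: subdiff_def)
    have 2: "h y + ereal ((x - y) \<bullet> (b - y)) \<le> h b" using sub by (simp add: subdiff_def)
    let ?u = "x - y" and ?v = "a - b"
    have "(y - x) \<bullet> (a - x) + (x - y) \<bullet> (b - y) = ?u \<bullet> ?u - ?u \<bullet> ?v"
      by (simp add: inner_diff_left inner_diff_right inner_commute)
    moreover have "0 \<le> (?u - ?v) \<bullet> (?u - ?v)" by simp
    then have "0 \<le> ?u \<bullet> ?u - 2 * (?u \<bullet> ?v) + ?v \<bullet> ?v"
      by (simp only: inner_diff_left inner_diff_right inner_commute) argo
    ultimately have "(norm ?u)\<^sup>2 / 2 \<le> (y - x) \<bullet> (a - x) + (x - y) \<bullet> (b - y) + (norm ?v)\<^sup>2 / 2"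
      unfolding power2_norm_eq_inner by argo
    then show ?thesis using 1 2 by (cases "f a"; cases "h b") (auto simp: r s)
  qed
  then show "(x, y) \<in> argmin (\<lambda>(x, y). f x + h y + ereal ((norm (x - y))\<^sup>2 / 2))"
    by (auto simp: argmin_iff)
qed

text \<open>For fixed \<open>x\<close> the inner infimum of the coupled objective is attained at \<open>prox h x\<close>, so \<open>x\<close> is
  optimal exactly if \<open>(x, prox h x)\<close> is optimal for the coupled problem.\<close>

lemma argmin_partial_envelope:
  fixes f h :: "'a::{real_inner, complete_space} \<Rightarrow> ereal"
  assumes f: "proper f" "lsc f" "ereal_convex f"
    and h: "proper h" "lsc h" "ereal_convex h"
  shows "argmin (\<lambda>x. f x + moreau_env 1 h x) = Fix (prox f \<circ> prox h)"
proof (intro set_eqI)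
  fix x
  let ?g = "\<lambda>(x, y). f x + h y + ereal ((norm (x - y))\<^sup>2 / 2)"
  have env: "f a + moreau_env 1 h a = ?g (a, prox h a)" for a
    by (simp add: moreau_env_eq[OF h] add.assoc)
  have env_le: "?g (a, prox h a) \<le> ?g (a, b)" for a b
    using prox_minimizes[OF h, of a] by (auto simp: add.assoc intro: add_left_mono)
  have "x \<in> argmin (\<lambda>x. f x + moreau_env 1 h x) \<longleftrightarrow> (x, prox h x) \<in> argmin ?g"
    unfolding argmin_iff env
  proof (intro iffI allI)
    fix q :: "'a \<times> 'a"
    assume min: "\<forall>a. ?g (x, prox h x) \<le> ?g (a, prox h a)"
    have "?g (x, prox h x) \<le> ?g (fst q, prox h (fst q))" using min by (rule spec)
    also have "\<dots> \<le> ?g (fst q, snd q)" by (rule env_le)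
    finally show "?g (x, prox h x) \<le> ?g q" by (simp only: prod.collapse)
  next
    fix a assume "\<forall>q. ?g (x, prox h x) \<le> ?g q"
    then show "?g (x, prox h x) \<le> ?g (a, prox h a)" by (rule spec)
  qed
  also have "\<dots> \<longleftrightarrow> x \<in> Fix (prox f \<circ> prox h)"
    unfolding argmin_coupled[OF f h] by (auto simp: Fix_def)
  finally show "x \<in> argmin (\<lambda>x. f x + moreau_env 1 h x) \<longleftrightarrow> x \<in> Fix (prox f \<circ> prox h)" .
qed

section \<open>The proximal average\<close>

text \<open>Take any decomposition \<open>w' = l1 a + l2 b\<close> and sum the two subgradient inequalities with weights
  \<open>l1\<close> and \<open>l2\<close>. The quadratic term in the definition of the proximal average is such that
  the surplus over the linear bound at \<open>w\<close> is \<open>(l1 l2 / 2) \<parallel>(a - b) - (x - y)\<parallel>\<^sup>2 \<ge> 0\<close>. In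
  particular the infimum at \<open>w\<close> is attained at \<open>(x, y)\<close>.\<close>

lemma prox_avg_subgradient:
  fixes f1 f2 :: "'a::real_inner \<Rightarrow> ereal"
  assumes proper: "proper f1" "proper f2"
    and weights: "l1 > 0" "l2 > 0" "l1 + l2 = 1"
    and sub: "z - x \<in> subdiff f1 x" "z - y \<in> subdiff f2 y"
  defines "w \<equiv> l1 *\<^sub>R x + l2 *\<^sub>R y"
  shows "proper (prox_avg f1 f2 l1 l2)" and "z - w \<in> subdiff (prox_avg f1 f2 l1 l2) w"
proof -
  let ?p = "prox_avg f1 f2 l1 l2"
  obtain r where r: "f1 x = ereal r" using subdiff_finite[OF proper(1) sub(1)] .
  obtain s where s: "f2 y = ereal s" using subdiff_finite[OF proper(2) sub(2)] .
  define c where "c = l1 * r + l2 * s + l1 * l2 / 2 * (norm (x - y))\<^sup>2"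
  have l2: "l2 = 1 - l1" using weights by simp
  have "?p w \<le> (case (x, y) of (a, b) \<Rightarrow>
      ereal l1 * f1 a + ereal l2 * f2 b + ereal (l1 * l2 / 2 * (norm (a - b))\<^sup>2))"
    unfolding prox_avg_def by (rule INF_lower) (simp add: w_def)
  then have upper: "?p w \<le> ereal c" by (simp add: r s c_def)
  have lower: "ereal (c + (z - w) \<bullet> (w' - w)) \<le> ?p w'" for w'
    unfolding prox_avg_def
  proof (rule INF_greatest)
    fix q assume "q \<in> {(a, b). w' = l1 *\<^sub>R a + l2 *\<^sub>R b}"
    then obtain a b where q: "q = (a, b)" and w': "w' = l1 *\<^sub>R a + l2 *\<^sub>R b" by auto
    have 1: "f1 x + ereal ((z - x) \<bullet> (a - x)) \<le> f1 a" using sub by (simp add: subdiff_def)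
    have 2: "f2 y + ereal ((z - y) \<bullet> (b - y)) \<le> f2 b" using sub by (simp add: subdiff_def)
    have "c + (z - w) \<bullet> (w' - w) + l1 * l2 / 2 * (norm ((a - b) - (x - y)))\<^sup>2
        = l1 * (r + (z - x) \<bullet> (a - x)) + l2 * (s + (z - y) \<bullet> (b - y)) + l1 * l2 / 2 * (norm (a - b))\<^sup>2"
      unfolding c_def w' w_def l2 power2_norm_eq_inner
      by (simp add: inner_add_left inner_add_right inner_diff_left inner_diff_right inner_commute field_simps)
    moreover have "0 \<le> l1 * l2 / 2 * (norm ((a - b) - (x - y)))\<^sup>2" using weights by simp
    ultimately have key: "c + (z - w) \<bullet> (w' - w)
        \<le> l1 * (r + (z - x) \<bullet> (a - x)) + l2 * (s + (z - y) \<bullet> (b - y)) + l1 * l2 / 2 * (norm (a - b))\<^sup>2"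
      by linarith
    have "ereal l1 * ereal (r + (z - x) \<bullet> (a - x)) \<le> ereal l1 * f1 a"
      using 1 weights by (intro ereal_mult_left_mono) (auto simp: r)
    moreover have "ereal l2 * ereal (s + (z - y) \<bullet> (b - y)) \<le> ereal l2 * f2 b"
      using 2 weights by (intro ereal_mult_left_mono) (auto simp: s)
    ultimately have "ereal (l1 * (r + (z - x) \<bullet> (a - x)) + l2 * (s + (z - y) \<bullet> (b - y)) + l1 * l2 / 2 * (norm (a - b))\<^sup>2)
        \<le> ereal l1 * f1 a + ereal l2 * f2 b + ereal (l1 * l2 / 2 * (norm (a - b))\<^sup>2)"
      by (metis add_mono plus_ereal.simps(1) times_ereal.simps(1) order_refl)
    with key show "ereal (c + (z - w) \<bullet> (w' - w)) \<le> (case q of (a, b) \<Rightarrow>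
        ereal l1 * f1 a + ereal l2 * f2 b + ereal (l1 * l2 / 2 * (norm (a - b))\<^sup>2))"
      unfolding q prod.case by (meson ereal_less_eq(3) order_trans)
  qed
  have "?p w' \<noteq> -\<infinity>" for w' using lower[of w'] by auto
  moreover have "?p w \<noteq> \<infinity>" using upper by auto
  ultimately show "proper ?p" by (auto simp: proper_def)
  show "z - w \<in> subdiff ?p w"
    using upper lower by (auto simp: subdiff_def intro: order_trans[OF add_right_mono[OF upper]])
qed

section \<open>Rescaled functions\<close>

lemma proper_divide:
  assumes "proper f" "l > 0"
  shows "proper (\<lambda>v. f v / ereal l)"
proof -
  have "(f v / ereal l = -\<infinity> \<longleftrightarrow> f v = -\<infinity>) \<and> (f v / ereal l = \<infinity> \<longleftrightarrow> f v = \<infinity>)" for v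
    using assms(2) by (cases "f v") auto
  then show ?thesis using assms(1) by (simp add: proper_def)
qed

lemma lsc_divide:
  assumes "lsc f" "l > 0"
  shows "lsc (\<lambda>v. f v / ereal l)"
proof (rule lsc_eventuallyI)
  fix x c assume "c < f x / ereal l"
  moreover have eq: "c < b / ereal l \<longleftrightarrow> c * ereal l < b" for b
    using assms(2) by (cases b; cases c) (auto simp: field_simps)
  ultimately show "\<forall>\<^sub>F y in nhds x. c < f y / ereal l"
    using lsc_eventually[OF assms(1)] by simp
qed

lemma ereal_convex_divide:
  assumes "ereal_convex f" "l > 0"
  shows "ereal_convex (\<lambda>v. f v / ereal l)"
  unfolding ereal_convex_def
proof (intro allI ballI)
  fix x y and t :: real assume t: "t \<in> {0<..<1}"
  have "f ((1 - t) *\<^sub>R x + t *\<^sub>R y) / ereal l \<le> (ereal (1 - t) * f x + ereal t * f y) / ereal l"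
    using ereal_convexD[OF assms(1)] assms(2) t by (intro ereal_divide_right_mono) auto
  also have "\<dots> = ereal (1 - t) * (f x / ereal l) + ereal t * (f y / ereal l)"
    using assms(2) t by (cases "f x"; cases "f y") (auto simp: field_simps)
  finally show "f ((1 - t) *\<^sub>R x + t *\<^sub>R y) / ereal l
      \<le> ereal (1 - t) * (f x / ereal l) + ereal t * (f y / ereal l)" .
qed

text \<open>Rescaling turns the proximal steps for \<open>f1 / l2\<close> and \<open>f2 / l1\<close> into conditions on the
  subgradients \<open>l2 (y - x)\<close> of \<open>f1\<close> and \<open>l1 (x - y)\<close> of \<open>f2\<close>.\<close>

lemma subdiff_divide:
  assumes "l > 0"
  shows "u \<in> subdiff (\<lambda>v. f v / ereal l) x \<longleftrightarrow> l *\<^sub>R u \<in> subdiff f x"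
proof -
  have "f x / ereal l + ereal k \<le> f a / ereal l \<longleftrightarrow> f x + ereal (l * k) \<le> f a" for a k
  proof -
    have "r / l + k \<le> s / l \<longleftrightarrow> r + l * k \<le> s" for r s
    proof -
      have "r / l + k = (r + l * k) / l" using assms by (simp add: add_divide_distrib)
      then show ?thesis using assms by (simp add: divide_le_cancel)
    qed
    then show ?thesis using assms by (cases "f x"; cases "f a") auto
  qed
  then show ?thesis by (simp add: subdiff_def)
qed

section \<open>Minimizers, fixed points and the proximal average\<close>

theorem theorem4p7:
  fixes f1 f2 :: "'a::{real_inner, complete_space} \<Rightarrow> ereal"
    and l1 l2 :: real
    and S :: "('a \<times> 'a) set" and E F :: "'a set"
    and g :: "'a \<times> 'a \<Rightarrow> ereal" and g1 g2 g3 p :: "'a \<Rightarrow> ereal"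
  assumes f1: "proper f1" "lsc f1" "ereal_convex f1"
    and f2: "proper f2" "lsc f2" "ereal_convex f2"
    and weights: "l1 > 0" "l2 > 0" "l1 + l2 = 1"
    and S_eq: "S = {(x, y). x = prox (\<lambda>v. f1 v / ereal l2) y \<and> y = prox (\<lambda>v. f2 v / ereal l1) x}"
    and E_eq: "E = Fix (prox (\<lambda>v. f1 v / ereal l2) \<circ> prox (\<lambda>v. f2 v / ereal l1))"
    and F_eq: "F = Fix (prox (\<lambda>v. f2 v / ereal l1) \<circ> prox (\<lambda>v. f1 v / ereal l2))"
    and g_eq: "g = (\<lambda>(x, y). f1 x / ereal l2 + f2 y / ereal l1 + ereal ((norm (x - y))\<^sup>2 / 2))"
    and g1_eq: "g1 = (\<lambda>x. f1 x / ereal l2 + moreau_env 1 (\<lambda>v. f2 v / ereal l1) x)"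
    and g2_eq: "g2 = (\<lambda>y. moreau_env 1 (\<lambda>v. f1 v / ereal l2) y + f2 y / ereal l1)"
    and g3_eq: "g3 = (\<lambda>z. ereal l1 * moreau_env 1 f1 z + ereal l2 * moreau_env 1 f2 z)"
    and p_eq: "p = prox_avg f1 f2 l1 l2"
  shows
    "(S = argmin g \<and> argmin g \<subseteq> E \<times> F) \<and>
     E = argmin g1 \<and>
     F = argmin g2 \<and>
     (argmin p = argmin g3 \<and>
      argmin g3 =
        (\<lambda>z. l1 *\<^sub>R yosida1 (subdiff f1) z + l2 *\<^sub>R yosida1 (subdiff f2) z) -` {0}) \<and>
     (argmin p = {l1 *\<^sub>R x + l2 *\<^sub>R y | x y. (x, y) \<in> S} \<and>
      {l1 *\<^sub>R x + l2 *\<^sub>R y | x y. (x, y) \<in> S} = Fix (prox p) \<and>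
      Fix (prox p) = Fix (\<lambda>z. l1 *\<^sub>R prox f1 z + l2 *\<^sub>R prox f2 z)) \<and>
     (closed S \<and> convex S \<and>
      closed E \<and> convex E \<and>
      closed F \<and> convex F \<and>
      closed (Fix (\<lambda>z. l1 *\<^sub>R prox f1 z + l2 *\<^sub>R prox f2 z)) \<and>
      convex (Fix (\<lambda>z. l1 *\<^sub>R prox f1 z + l2 *\<^sub>R prox f2 z)))"
proof -
  let ?h1 = "\<lambda>v. f1 v / ereal l2" and ?h2 = "\<lambda>v. f2 v / ereal l1"
  let ?T = "\<lambda>z. l1 *\<^sub>R prox f1 z + l2 *\<^sub>R prox f2 z"
  note h1 = proper_divide[OF f1(1) weights(2)] lsc_divide[OF f1(2) weights(2)]
    ereal_convex_divide[OF f1(3) weights(2)]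
  note h2 = proper_divide[OF f2(1) weights(1)] lsc_divide[OF f2(2) weights(1)]
    ereal_convex_divide[OF f2(3) weights(1)]
  have l1: "l1 = 1 - l2" using weights(3) by simp

  have S_iff: "(x, y) \<in> S \<longleftrightarrow> x = prox ?h1 y \<and> y = prox ?h2 x" for x y
    by (simp add: S_eq)
  have S: "S = argmin g"
  proof -
    have "(x, y) \<in> S \<longleftrightarrow> (x, y) \<in> argmin g" for x y
      unfolding S_iff g_eq argmin_coupled[OF h1 h2] ..
    then show ?thesis by auto
  qed
  have SEF: "argmin g \<subseteq> E \<times> F"
  proof -
    have "x \<in> E \<and> y \<in> F" if "(x, y) \<in> S" for x y
    proof -
      have "prox ?h1 y = x" "prox ?h2 x = y" 
        using that[unfolded S_iff, THEN conjunct1, symmetric]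
          that[unfolded S_iff, THEN conjunct2, symmetric] .
      then show ?thesis by (simp only: E_eq F_eq Fix_def comp_apply mem_Collect_eq)
    qed
    then show ?thesis unfolding S[symmetric] by auto
  qed
  have E: "E = argmin g1"
    unfolding E_eq g1_eq argmin_partial_envelope[OF h1 h2] ..
  have "g2 = (\<lambda>y. ?h2 y + moreau_env 1 ?h1 y)"
    unfolding g2_eq by (simp add: add.commute)
  then have F: "F = argmin g2"
    unfolding F_eq using argmin_partial_envelope[OF h2 h1] by simp

  have zero_iff: "l1 *\<^sub>R (z - prox f1 z) + l2 *\<^sub>R (z - prox f2 z) = 0 \<longleftrightarrow> z \<in> Fix ?T" for z
  proof -
    have "l1 *\<^sub>R (z - prox f1 z) + l2 *\<^sub>R (z - prox f2 z) = z - ?T z"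
      by (simp add: l1 algebra_simps)
    then show ?thesis by (auto simp: Fix_def)
  qed
  have g3: "argmin g3 = Fix ?T"
    unfolding set_eq_iff g3_eq argmin_moreau_env_combination[OF f1 f2 weights] zero_iff by simp
  have zeros: "(\<lambda>z. l1 *\<^sub>R yosida1 (subdiff f1) z + l2 *\<^sub>R yosida1 (subdiff f2) z) -` {0} = Fix ?T"
    unfolding set_eq_iff vimage_def yosida1_def prox_def[symmetric] using zero_iff by simp

  have sub: "z - prox f1 z \<in> subdiff f1 (prox f1 z)" "z - prox f2 z \<in> subdiff f2 (prox f2 z)" for z
    by (rule prox_subgradient[OF f1], rule prox_subgradient[OF f2])
  have proper_p: "proper p" and sub_p: "z - ?T z \<in> subdiff p (?T z)" for z
    unfolding p_eq by (rule prox_avg_subgradient[OF f1(1) f2(1) weights sub])+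
  have prox_p: "prox p = ?T"
    by (rule ext) (rule prox_eqI[OF proper_p sub_p])
  have p: "argmin p = Fix (prox p)"
  proof (intro set_eqI iffI)
    fix z assume "z \<in> argmin p"
    then have "z - z \<in> subdiff p z" by (simp add: argmin_iff_zero_subgradient)
    then show "z \<in> Fix (prox p)" using prox_eqI[OF proper_p] by (simp add: Fix_def)
  next
    fix z assume "z \<in> Fix (prox p)"
    then have "?T z = z" by (simp add: prox_p Fix_def)
    then show "z \<in> argmin p" using sub_p[of z] by (simp add: argmin_iff_zero_subgradient)
  qed

  \<comment> \<open>By \<open>diff\<close>, the subgradients in \<open>S_sub\<close> are \<open>z - x\<close> and \<open>z - y\<close> for
    \<open>z = l1 x + l2 y\<close>, so \<open>(x, y) \<in> S\<close> says that \<open>x = prox f1 z\<close> and \<open>y = prox f2 z\<close>.\<close>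
  have S_sub: "(x, y) \<in> S \<longleftrightarrow> l2 *\<^sub>R (y - x) \<in> subdiff f1 x \<and> l1 *\<^sub>R (x - y) \<in> subdiff f2 y" for x y
    unfolding S_iff prox_iff_subgradient[OF h1] prox_iff_subgradient[OF h2]
      subdiff_divide[OF weights(2)] subdiff_divide[OF weights(1)] ..
  have diff: "(l1 *\<^sub>R x + l2 *\<^sub>R y) - x = l2 *\<^sub>R (y - x)" "(l1 *\<^sub>R x + l2 *\<^sub>R y) - y = l1 *\<^sub>R (x - y)"
    for x y :: 'a
    by (simp_all add: l1 algebra_simps)
  have avg_S: "{l1 *\<^sub>R x + l2 *\<^sub>R y | x y. (x, y) \<in> S} = Fix ?T"
  proof (intro set_eqI iffI)
    fix z assume "z \<in> {l1 *\<^sub>R x + l2 *\<^sub>R y | x y. (x, y) \<in> S}"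
    then obtain x y where z: "z = l1 *\<^sub>R x + l2 *\<^sub>R y" and "(x, y) \<in> S" by blast
    then have "z - x \<in> subdiff f1 x" "z - y \<in> subdiff f2 y" by (simp_all add: S_sub diff)
    then have "prox f1 z = x" "prox f2 z = y" using prox_eqI f1(1) f2(1) by blast+
    then show "z \<in> Fix ?T" by (simp add: Fix_def z)
  next
    fix z assume "z \<in> Fix ?T"
    then have z: "z = ?T z" by (simp add: Fix_def)
    have "(prox f1 z, prox f2 z) \<in> S"
      using sub[of z] unfolding S_sub diff[symmetric] z[symmetric] by (rule conjI)
    then show "z \<in> {l1 *\<^sub>R x + l2 *\<^sub>R y | x y. (x, y) \<in> S}" using z by blast
  qed

  have swap: "norm ((\<lambda>(x, y). (prox ?h1 y, prox ?h2 x)) u - (\<lambda>(x, y). (prox ?h1 y, prox ?h2 x)) v)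
      \<le> norm (u - v)" for u v
  proof (cases u; cases v)
    fix a b c d assume "u = (a, b)" "v = (c, d)"
    moreover have "(norm (prox ?h1 b - prox ?h1 d))\<^sup>2 + (norm (prox ?h2 a - prox ?h2 c))\<^sup>2
        \<le> (norm (b - d))\<^sup>2 + (norm (a - c))\<^sup>2"
      by (intro add_mono power_mono prox_nonexpansive h1 h2 norm_ge_zero)
    ultimately show ?thesis by (simp add: norm_Pair add.commute)
  qed
  have S_Fix: "S = Fix (\<lambda>(x, y). (prox ?h1 y, prox ?h2 x))"
    unfolding S_eq Fix_def by (simp only: split_def prod_eq_iff fst_conv snd_conv eq_commute)
  have comp: "norm ((prox ?h1 \<circ> prox ?h2) x - (prox ?h1 \<circ> prox ?h2) y) \<le> norm (x - y)"
    "norm ((prox ?h2 \<circ> prox ?h1) x - (prox ?h2 \<circ> prox ?h1) y) \<le> norm (x - y)" for x y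
    unfolding comp_apply
    by (rule order_trans[OF prox_nonexpansive[OF h1] prox_nonexpansive[OF h2]],
        rule order_trans[OF prox_nonexpansive[OF h2] prox_nonexpansive[OF h1]])
  have avg: "norm (?T x - ?T y) \<le> norm (x - y)" for x y
  proof -
    have "?T x - ?T y = l1 *\<^sub>R (prox f1 x - prox f1 y) + l2 *\<^sub>R (prox f2 x - prox f2 y)"
      by (simp add: algebra_simps)
    also have "norm \<dots> \<le> l1 * norm (prox f1 x - prox f1 y) + l2 * norm (prox f2 x - prox f2 y)"
      using norm_triangle_ineq[of "l1 *\<^sub>R (prox f1 x - prox f1 y)" "l2 *\<^sub>R (prox f2 x - prox f2 y)"]
        weights(1,2) by simp
    also have "\<dots> \<le> l1 * norm (x - y) + l2 * norm (x - y)"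
      using weights(1,2) prox_nonexpansive[OF f1] prox_nonexpansive[OF f2]
      by (intro add_mono mult_left_mono) auto
    also have "\<dots> = norm (x - y)" using weights(3) by (metis distrib_right mult_1)
    finally show ?thesis .
  qed
  have regular: "closed S" "convex S" "closed E" "convex E" "closed F" "convex F"
    "closed (Fix ?T)" "convex (Fix ?T)"
    unfolding S_Fix E_eq F_eq
    by (rule Fix_nonexpansive_closed Fix_nonexpansive_convex, rule swap comp avg)+

  show ?thesis
    using S SEF E F p prox_p g3 zeros avg_S regular by simp
qed

end
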